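(* Let $d\ge2$ be an integer, let $1<n_1<n_2<\cdots<n_d$ be integers, let $\mathcal{I}$ be a non-empty subset of $\prod_{l=1}^d\{0,\dots,n_l-1\}$ satisfying the very strong separation condition, and let $\{p_{\mathbf{i}}\}_{\mathbf{i}\in\mathcal{I}}$ be a probability vector with $p_{\mathbf{i}}>0$ for all $\mathbf{i}\in\mathcal{I}$. Let $\mu$ be the associated self-affine measure on the corresponding Bedford–McMullen sponge. Then \[ \overline{\dim}_{\mathrm{reg}}\,\mu\ =\ \sum_{l=1}^d\ \max_{\mathbf{i}\in\mathcal{I}}\ \frac{-\log p_l(\mathbf{i})}{\log n_l}. \]
   Context: For $\mathbf{i}=(i_1,\dots,i_d)\in\mathcal{I}$ let $S_{\mathbf{i}}:[0,1]^d\to[0,1]^d$ be $S_{\mathbf{i}}(x_1,\dots,x_d)=\left(\frac{x_1+i_1}{n_1},\dots,\frac{x_d+i_d}{n_d}\right)$. The Bedford–McMullen sponge $F$ is the unique non-empty compact set with $F=\bigcup_{\mathbf{i}\in\mathcal{I}}S_{\mathbf{i}}(F)$, and the self-affine measure $\mu$ is the unique Borel probability measure with $\mu=\sum_{\mathbf{i}\in\mathcal{I}}p_{\mathbf{i}}\,\mu\circ S_{\mathbf{i}}^{-1}$; its support is $F$. Very strong separation condition (VSSC): whenever $l\in\{1,\dots,d\}$ and $(i_1,\dots,i_d),(j_1,\dots,j_d)\in\mathcal{I}$ satisfy $i_1=j_1,\dots,i_{l-1}=j_{l-1}$ and $i_l\ne j_l$, then $|i_l-j_l|>1$. For $l=1,\dots,d$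 and $\mathbf{i}=(i_1,\dots,i_d)\in\mathcal{I}$, \[ p_l(\mathbf{i})=\frac{\sum_{\mathbf{j}\in\mathcal{I}:\ j_1=i_1,\dots,j_{l-1}=i_{l-1},\,j_l=i_l}p_{\mathbf{j}}}{\sum_{\mathbf{j}\in\mathcal{I}:\ j_1=i_1,\dots,j_{l-1}=i_{l-1}}p_{\mathbf{j}}}, \] where for $l=1$ the denominator is $1$. Upper regularity dimension: with $B(x,r)$ the open ball, $\overline{\dim}_{\mathrm{reg}}\,\mu$ is the infimum of all $s\ge 0$ for which there is a constant $C>0$ such that for all $0<r<R$ and all $x\in\mathrm{supp}(\mu)$, $\frac{\mu(B(x,R))}{\mu(B(x,r))}\le C\left(\frac{R}{r}\right)^s$ (with $\inf\emptyset=+\infty$). *)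

theory Defs
  imports "HOL-Probability.Probability_Measure"
begin

text \<open>The coordinates \<open>1, \<dots>, d\<close> are the elements of a finite linearly ordered
  index type \<open>'d\<close>.\<close>

type_synonym 'd multi_index = "'d \<Rightarrow> nat"

definition unit_cube :: "(real ^ 'd) set" where
  "unit_cube = {x. \<forall>l. 0 \<le> x $ l \<and> x $ l \<le> 1}"

definition sponge_map :: "('d \<Rightarrow> nat) \<Rightarrow> 'd multi_index \<Rightarrow> real ^ 'd \<Rightarrow> real ^ 'd" where
  "sponge_map n i x = (\<chi> l. (x $ l + real (i l)) / real (n l))"

definition very_strong_separation :: "('d::linorder) multi_index set \<Rightarrow> bool" where
  "very_strong_separation I \<longleftrightarrow>
     (\<forall>l. \<forall>i\<in>I. \<forall>j\<in>I. (\<forall>k<l. i k = j k) \<and> i l \<noteq> j l \<longrightarrow> \<bar>int (i l) - int (j l)\<bar> > 1)"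

text \<open>The maps are self-maps of the unit cube, so preimages are taken within the cube.
  Evaluating the equation at the whole space shows that \<open>\<mu>\<close> is concentrated on the cube.\<close>

definition self_affine_measure ::
  "('d::finite \<Rightarrow> nat) \<Rightarrow> 'd multi_index set \<Rightarrow> ('d multi_index \<Rightarrow> real) \<Rightarrow> (real ^ 'd) measure \<Rightarrow> bool"
where
  "self_affine_measure n I p \<mu> \<longleftrightarrow>
     sets \<mu> = sets borel \<and> prob_space \<mu> \<and>
     (\<forall>A\<in>sets borel. emeasure \<mu> A =
        (\<Sum>i\<in>I. ennreal (p i) * emeasure \<mu> {x \<in> unit_cube. sponge_map n i x \<in> A}))"

text \<open>For the least \<open>l\<close> the denominator is the sum of all weights, hence \<open>1\<close> for a
  probability vector.\<close>

definition cond_weight ::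
  "('d::linorder) multi_index set \<Rightarrow> ('d multi_index \<Rightarrow> real) \<Rightarrow> 'd \<Rightarrow> 'd multi_index \<Rightarrow> real"
where
  "cond_weight I p l i =
     (\<Sum>j | j \<in> I \<and> (\<forall>k<l. j k = i k) \<and> j l = i l. p j) /
     (\<Sum>j | j \<in> I \<and> (\<forall>k<l. j k = i k). p j)"

definition measure_support :: "'a::metric_space measure \<Rightarrow> 'a set" where
  "measure_support \<mu> = {x. \<forall>r>0. emeasure \<mu> (ball x r) > 0}"

text \<open>Meant for finite Borel measures; in the complete lattice \<open>ereal\<close> the infimum of
  the empty set is \<open>\<infinity>\<close>.\<close>

definition upper_regularity_dim :: "'a::metric_space measure \<Rightarrow> ereal" where
  "upper_regularity_dim \<mu> =
     Inf {ereal s | s. s \<ge> 0 \<and>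
       (\<exists>C>0. \<forall>r R. 0 < r \<and> r < R \<longrightarrow>
          (\<forall>x\<in>measure_support \<mu>.
             measure \<mu> (ball x R) / measure \<mu> (ball x r) \<le> C * (R / r) powr s))}"

end

theory Submission
  imports Defs
begin

text \<open>
  Balls are compared with approximate cubes. Fix a digit sequence \<open>\<sigma>\<close> in \<open>I\<close>
  and a number \<open>\<kappa> l\<close> of digits to be prescribed in each coordinate \<open>l\<close>, nonincreasing in \<open>l\<close>;
  the approximate cube is the box of points whose \<open>l\<close>-th coordinate has an \<open>n l\<close>-adic expansion
  beginning with the first \<open>\<kappa> l\<close> digits of \<open>\<sigma>\<close>. Peeling off one symbol with the self-affinity of
  \<open>\<mu>\<close> and telescoping the conditional weights gives its mass exactly
  (\<open>prob_approx_cube\<close>): it is the product of \<open>p_l(\<sigma> t)\<close> over all \<open>l\<close> and all \<open>t < \<kappa> l\<close>.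
  At a scale \<open>\<rho> \<le> 1\<close> prescribe as many digits as keep all sides at least \<open>\<rho>\<close>. Separation then
  confines the mass of \<open>ball x \<rho>\<close> to the approximate cube around \<open>x\<close>
  (\<open>prob_ball_upper\<close>), and conversely this cube lies in a ball whose radius is a constant
  multiple of \<open>\<rho>\<close> (\<open>prob_ball_lower\<close>).

  Passing from scale \<open>\<rho>\<close> to a smaller scale \<open>\<rho>'\<close> therefore multiplies the mass by one factor
  \<open>p_l(\<sigma> t)\<close> for each newly prescribed digit, and about \<open>log (\<rho> / \<rho>') / log (n l)\<close> new
  digits occur in coordinate \<open>l\<close>. If \<open>s_l\<close> is the maximum of \<open>- log p_l(i) / log (n l)\<close>, each
  factor is at least \<open>n l\<close> to the power \<open>- s_l\<close>, so the total loss is at most a constant times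
  \<open>\<rho> / \<rho>'\<close> to the power \<open>\<Sum>l. s_l\<close> (\<open>ball_ratio_upper\<close>). This is the upper bound for the
  dimension.

  It is sharp because the extremal symbols for different coordinates can be used
  simultaneously. As the \<open>n l\<close> are strictly increasing, for \<open>\<rho>' = \<rho> powr (1 + \<epsilon>)\<close> with small
  \<open>\<epsilon>\<close> the sets of positions of newly prescribed digits belonging to different coordinates are
  disjoint, so a single sequence \<open>\<sigma>\<close> can be extremal for coordinate \<open>l\<close> on the \<open>l\<close>-th set,
  for every \<open>l\<close>. A support point coded by it loses mass at the maximal rate between these two
  scales, whose ratio can be made arbitrarily large by taking \<open>\<rho>\<close> small
  (\<open>large_ball_ratio\<close>).
\<close>

section \<open>Self-affinity for real-valued probabilities\<close>

locale vssc_sponge =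
  fixes n :: "'d::{finite, linorder} \<Rightarrow> nat"
    and I :: "'d multi_index set"
    and p :: "'d multi_index \<Rightarrow> real"
    and \<mu> :: "(real ^ ('d::{finite, linorder})) measure"
  assumes n_gt_1: "\<And>l. 1 < n l"
    and n_strict_mono: "strict_mono n"
    and I_nonempty: "I \<noteq> {}"
    and digits: "I \<subseteq> {i. \<forall>l. i l \<in> {0..n l - 1}}"
    and separation: "very_strong_separation I"
    and p_pos: "\<And>i. i \<in> I \<Longrightarrow> p i > 0"
    and p_sum: "(\<Sum>i\<in>I. p i) = 1"
    and self_affine: "self_affine_measure n I p \<mu>"
begin

lemma finite_I: "finite I"
  using p_sum by (metis sum.infinite zero_neq_one)

lemma digit_le: "i \<in> I \<Longrightarrow> real (i l) + 1 \<le> real (n l)"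
proof -
  assume "i \<in> I"
  then have "i l \<le> n l - 1" using digits by auto
  then show ?thesis using n_gt_1[of l] by linarith
qed

lemma sets_mu [simp, measurable_cong]: "sets \<mu> = sets borel"
  using self_affine by (simp add: self_affine_measure_def)

lemma space_mu [simp]: "space \<mu> = UNIV"
  using sets_eq_imp_space_eq[OF sets_mu] by simp

sublocale prob_space \<mu>
  using self_affine by (simp add: self_affine_measure_def)

lemma continuous_sponge_map: "continuous_on UNIV (sponge_map n i :: real ^ ('d::{finite, linorder}) \<Rightarrow> _)"
  unfolding sponge_map_def using n_gt_1
  by (intro continuous_intros) (metis of_nat_0_eq_iff not_one_less_zero)

lemma closed_unit_cube: "closed (unit_cube :: (real ^ ('d::{finite, linorder})) set)"
proof -
  have "unit_cube = (\<Inter>l. {x :: real ^ ('d::{finite, linorder}). 0 \<le> x $ l} \<inter> {x. x $ l \<le> 1})"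
    by (auto simp: unit_cube_def)
  also have "closed \<dots>"
    by (intro closed_INT ballI closed_Int closed_Collect_le continuous_intros)
  finally show ?thesis .
qed

lemma unit_cube_borel [measurable]: "(unit_cube :: (real ^ ('d::{finite, linorder})) set) \<in> sets borel"
  by (rule borel_closed[OF closed_unit_cube])

lemma preimage_borel:
  assumes "A \<in> sets borel"
  shows "{x \<in> unit_cube. sponge_map n i x \<in> A} \<in> sets (borel :: (real ^ ('d::{finite, linorder})) measure)"
proof -
  have "sponge_map n i \<in> borel_measurable (borel :: (real ^ ('d::{finite, linorder})) measure)"
    by (rule borel_measurable_continuous_onI[OF continuous_sponge_map])
  then show ?thesis using assms by measurable
qed

lemma measure_self_affine:
  assumes "A \<in> sets borel"
  shows "prob A = (\<Sum>i\<in>I. p i * prob {x \<in> unit_cube. sponge_map n i x \<in> A})"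
proof -
  have "ennreal (prob A) =
      (\<Sum>i\<in>I. ennreal (p i) * ennreal (prob {x \<in> unit_cube. sponge_map n i x \<in> A}))"
    using self_affine assms
    by (simp add: self_affine_measure_def emeasure_eq_measure[symmetric])
  also have "\<dots> = (\<Sum>i\<in>I. ennreal (p i * prob {x \<in> unit_cube. sponge_map n i x \<in> A}))"
    by (intro sum.cong refl) (simp add: ennreal_mult p_pos less_imp_le)
  also have "\<dots> = ennreal (\<Sum>i\<in>I. p i * prob {x \<in> unit_cube. sponge_map n i x \<in> A})"
    by (intro sum_ennreal mult_nonneg_nonneg measure_nonneg) (simp add: p_pos less_imp_le)
  finally show ?thesis
    by (subst (asm) ennreal_inj)
      (auto intro!: sum_nonneg mult_nonneg_nonneg simp: p_pos less_imp_le)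
qed

lemma prob_unit_cube: "prob unit_cube = 1"
proof -
  have "prob UNIV = (\<Sum>i\<in>I. p i * prob unit_cube)"
    by (subst measure_self_affine) auto
  then show ?thesis
    using p_sum prob_space by (simp add: sum_distrib_right[symmetric])
qed

lemma prob_Int_full:
  assumes "A \<in> sets borel" "G \<in> sets borel" "prob G = 1"
  shows "prob (G \<inter> A) = prob A"
proof -
  have "AE x in \<mu>. x \<in> G" using assms by (intro AE_prob_1) auto
  then show ?thesis
    by (intro finite_measure_eq_AE) (use assms in auto)
qed

section \<open>Approximate cubes\<close>

text \<open>The value of the first \<open>k\<close> digits of \<open>\<sigma>\<close> in coordinate \<open>l\<close>, read as an \<open>n l\<close>-adic
  fraction.\<close>

definition left_end :: "(nat \<Rightarrow> 'd multi_index) \<Rightarrow> nat \<Rightarrow> 'd \<Rightarrow> real" where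
  "left_end \<sigma> k l = (\<Sum>t<k. real (\<sigma> t l) / real (n l) ^ Suc t)"

text \<open>The boxes are closed, which makes nested intersections nonempty. Sharing of boundary points
  does no harm, because separated digits differ by at least two.\<close>

definition approx_cube :: "(nat \<Rightarrow> 'd multi_index) \<Rightarrow> ('d \<Rightarrow> nat) \<Rightarrow> (real ^ ('d::{finite, linorder})) set" where
  "approx_cube \<sigma> \<kappa> = {x. \<forall>l. left_end \<sigma> (\<kappa> l) l \<le> x $ l \<and>
                                x $ l \<le> left_end \<sigma> (\<kappa> l) l + 1 / real (n l) ^ \<kappa> l}"

lemma n_gt_0 [simp]: "0 < n l"
  using n_gt_1[of l] by simp

lemma n_pos: "real (n l) > 0"
  by simp

lemma left_end_0 [simp]: "left_end \<sigma> 0 l = 0"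
  by (simp add: left_end_def)

lemma left_end_Suc: "left_end \<sigma> (Suc k) l = left_end \<sigma> k l + real (\<sigma> k l) / real (n l) ^ Suc k"
  by (simp add: left_end_def)

lemma left_end_shift: "left_end \<sigma> (Suc k) l = (real (\<sigma> 0 l) + left_end (\<sigma> \<circ> Suc) k l) / real (n l)"
  unfolding left_end_def
  by (subst sum.lessThan_Suc_shift) (simp add: sum_divide_distrib add_divide_distrib mult.commute)

lemma left_end_cong: "(\<And>t. t < k \<Longrightarrow> \<sigma> t l = \<tau> t l) \<Longrightarrow> left_end \<sigma> k l = left_end \<tau> k l"
  by (simp add: left_end_def)

lemma right_end_decreasing:
  assumes "\<sigma> k \<in> I"
  shows "left_end \<sigma> (Suc k) l + 1 / real (n l) ^ Suc k \<le> left_end \<sigma> k l + 1 / real (n l) ^ k"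
proof -
  have "(real (\<sigma> k l) + 1) / real (n l) ^ Suc k \<le> real (n l) / real (n l) ^ Suc k"
    by (intro divide_right_mono digit_le assms) auto
  also have "\<dots> = 1 / real (n l) ^ k" using n_pos[of l] by simp
  finally show ?thesis by (simp add: left_end_Suc add_divide_distrib)
qed

lemma left_end_mono: "j \<le> k \<Longrightarrow> left_end \<sigma> j l \<le> left_end \<sigma> k l"
  unfolding left_end_def by (intro sum_mono2) auto

lemma right_end_antimono:
  assumes "range \<sigma> \<subseteq> I" "j \<le> k"
  shows "left_end \<sigma> k l + 1 / real (n l) ^ k \<le> left_end \<sigma> j l + 1 / real (n l) ^ j"
  using assms(2)
proof (induction k rule: dec_induct)
  case (step k)
  have "\<sigma> k \<in> I" using assms(1) by auto
  from right_end_decreasing[of \<sigma> k l, OF this] step.IH show ?case by linarith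
qed auto

lemma approx_cube_antimono:
  assumes "range \<sigma> \<subseteq> I" "\<And>l. \<kappa> l \<le> \<kappa>' l"
  shows "approx_cube \<sigma> \<kappa>' \<subseteq> approx_cube \<sigma> \<kappa>"
proof
  fix x assume x: "x \<in> approx_cube \<sigma> \<kappa>'"
  show "x \<in> approx_cube \<sigma> \<kappa>"
    unfolding approx_cube_def
  proof (safe)
    fix l
    have "left_end \<sigma> (\<kappa>' l) l \<le> x $ l" "x $ l \<le> left_end \<sigma> (\<kappa>' l) l + 1 / real (n l) ^ \<kappa>' l"
      using x by (auto simp: approx_cube_def)
    with left_end_mono[OF assms(2), of \<sigma> l l] right_end_antimono[OF assms(1) assms(2), of l l]
    show "left_end \<sigma> (\<kappa> l) l \<le> x $ l" "x $ l \<le> left_end \<sigma> (\<kappa> l) l + 1 / real (n l) ^ \<kappa> l"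
      by linarith+
  qed
qed

lemma approx_cube_0: "approx_cube \<sigma> (\<lambda>_. 0) = unit_cube"
  by (simp add: approx_cube_def unit_cube_def)

lemma approx_cube_eq_cbox:
  "approx_cube \<sigma> \<kappa> = cbox (\<chi> l. left_end \<sigma> (\<kappa> l) l) (\<chi> l. left_end \<sigma> (\<kappa> l) l + 1 / real (n l) ^ \<kappa> l)"
  by (auto simp: approx_cube_def cbox_def Basis_vec_def inner_axis)

lemma approx_cube_borel [measurable]: "approx_cube \<sigma> \<kappa> \<in> sets borel"
  by (simp add: approx_cube_eq_cbox)

section \<open>Mass of an approximate cube\<close>

lemma separated_digits:
  assumes "i \<in> I" "j \<in> I" "\<And>k. k < l \<Longrightarrow> i k = j k" "i l \<noteq> j l"
  shows "\<bar>real (i l) - real (j l)\<bar> \<ge> 2"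
proof -
  have "\<bar>int (i l) - int (j l)\<bar> > 1"
    using separation assms unfolding very_strong_separation_def by blast
  then show ?thesis by linarith
qed

text \<open>A map \<open>sponge_map n i\<close> either prefixes the digits demanded by the approximate cube, and
  then its preimage is the cube with the first symbol removed, or it conflicts with one of them.
  In the latter case monotonicity of \<open>\<kappa>\<close> ensures that at the first coordinate of conflict
  all earlier coordinates were demanded as well and agree, so the separation condition applies and
  pushes the image away from the cube.\<close>

lemma preimage_approx_cube:
  assumes \<sigma>: "range \<sigma> \<subseteq> I" and \<kappa>: "antimono \<kappa>" and i: "i \<in> I"
  shows "{x \<in> unit_cube. sponge_map n i x \<in> approx_cube \<sigma> \<kappa>} =
    (if \<forall>l\<in>{l. \<kappa> l \<noteq> 0}. i l = \<sigma> 0 l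
     then unit_cube \<inter> approx_cube (\<sigma> \<circ> Suc) (\<lambda>l. \<kappa> l - 1) else {})"
proof (cases "\<forall>l\<in>{l. \<kappa> l \<noteq> 0}. i l = \<sigma> 0 l")
  case True
  have "left_end \<sigma> (\<kappa> l) l \<le> sponge_map n i x $ l \<and>
        sponge_map n i x $ l \<le> left_end \<sigma> (\<kappa> l) l + 1 / real (n l) ^ \<kappa> l \<longleftrightarrow>
        left_end (\<sigma> \<circ> Suc) (\<kappa> l - 1) l \<le> x $ l \<and>
        x $ l \<le> left_end (\<sigma> \<circ> Suc) (\<kappa> l - 1) l + 1 / real (n l) ^ (\<kappa> l - 1)"
    if x: "x \<in> unit_cube" for x l
  proof (cases "\<kappa> l")
    case 0
    have "0 \<le> x $ l" "x $ l \<le> 1" using x by (auto simp: unit_cube_def)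
    then show ?thesis using 0 digit_le[OF i, of l] n_pos[of l]
      by (simp add: sponge_map_def divide_simps)
  next
    case (Suc k)
    then have "i l = \<sigma> 0 l" using True by auto
    moreover have "(real (\<sigma> 0 l) + left_end (\<sigma> \<circ> Suc) k l) / real (n l) + 1 / real (n l) ^ Suc k
        = (real (\<sigma> 0 l) + (left_end (\<sigma> \<circ> Suc) k l + 1 / real (n l) ^ k)) / real (n l)"
      using n_pos[of l] by (simp add: field_simps)
    ultimately show ?thesis using Suc n_pos[of l]
      by (simp add: sponge_map_def left_end_shift divide_le_cancel del: power_Suc)
  qed
  then show ?thesis using True by (auto simp: approx_cube_def)
next
  case False
  \<comment> \<open>the first coordinate in which \<open>i\<close> conflicts with a demanded digit\<close>
  define l where "l = Min {l. \<kappa> l \<noteq> 0 \<and> i l \<noteq> \<sigma> 0 l}"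
  have "l \<in> {l. \<kappa> l \<noteq> 0 \<and> i l \<noteq> \<sigma> 0 l}"
    unfolding l_def using False by (intro Min_in) auto
  then have l: "\<kappa> l \<noteq> 0" "i l \<noteq> \<sigma> 0 l" by auto
  have least: "i k = \<sigma> 0 k" if "k < l" for k
  proof (rule ccontr)
    assume "i k \<noteq> \<sigma> 0 k"
    moreover have "\<kappa> k \<noteq> 0" using l(1) antimonoD[OF \<kappa> less_imp_le[OF that]] by auto
    ultimately have "l \<le> k" unfolding l_def by (intro Min_le) auto
    then show False using that by simp
  qed
  have \<sigma>0: "\<sigma> 0 \<in> I" using \<sigma> by auto
  have sep: "\<bar>real (i l) - real (\<sigma> 0 l)\<bar> \<ge> 2"
    by (rule separated_digits[OF i \<sigma>0 least l(2)])
  have False if x: "x \<in> unit_cube" and S: "sponge_map n i x \<in> approx_cube \<sigma> \<kappa>" for x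
  proof -
    \<comment> \<open>the first digit in coordinate \<open>l\<close> alone already excludes \<open>x\<close>\<close>
    have "sponge_map n i x \<in> approx_cube \<sigma> (\<lambda>m. if m = l then 1 else 0)"
      by (rule subsetD[OF approx_cube_antimono[OF \<sigma>] S]) (use l(1) in auto)
    then have "real (\<sigma> 0 l) / real (n l) \<le> (x $ l + real (i l)) / real (n l)"
        "(x $ l + real (i l)) / real (n l) \<le> (real (\<sigma> 0 l) + 1) / real (n l)"
      by (auto simp: approx_cube_def sponge_map_def left_end_def add_divide_distrib
          dest: spec[of _ l])
    then have "real (\<sigma> 0 l) \<le> x $ l + real (i l)" "x $ l + real (i l) \<le> real (\<sigma> 0 l) + 1"
      using n_pos[of l] by (simp_all add: divide_le_cancel)
    moreover have "0 \<le> x $ l" "x $ l \<le> 1" using x by (auto simp: unit_cube_def)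
    ultimately show False using sep l(2) by linarith
  qed
  then show ?thesis using False by auto
qed

lemma sum_weight_pos:
  assumes "i \<in> I" "P i"
  shows "(\<Sum>j | j \<in> I \<and> P j. p j) > 0"
  by (rule sum_pos2[of _ i]) (use assms finite_I p_pos in \<open>auto intro: less_imp_le\<close>)

lemma cond_weight_pos: "i \<in> I \<Longrightarrow> cond_weight I p l i > 0"
  unfolding cond_weight_def by (intro divide_pos_pos sum_weight_pos) auto

lemma cond_weight_le_1: "i \<in> I \<Longrightarrow> cond_weight I p l i \<le> 1"
proof -
  assume i: "i \<in> I"
  have "(\<Sum>j | j \<in> I \<and> (\<forall>k<l. j k = i k) \<and> j l = i l. p j) \<le> (\<Sum>j | j \<in> I \<and> (\<forall>k<l. j k = i k). p j)"
    using finite_I p_pos by (intro sum_mono2) (auto intro: less_imp_le)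
  moreover have "(\<Sum>j | j \<in> I \<and> (\<forall>k<l. j k = i k). p j) > 0"
    by (rule sum_weight_pos[OF i]) auto
  ultimately show ?thesis unfolding cond_weight_def by (simp add: divide_le_eq_1)
qed

text \<open>The denominator of each conditional weight is the numerator of the preceding one, so on
  an initial segment of the coordinates the product telescopes.\<close>

lemma sum_weight_eq_prod:
  assumes i: "i \<in> I" and D: "\<And>l k. l \<in> D \<Longrightarrow> k < l \<Longrightarrow> k \<in> D"
  shows "(\<Sum>j | j \<in> I \<and> (\<forall>l\<in>D. j l = i l). p j) = (\<Prod>l\<in>D. cond_weight I p l i)"
  using finite[of D] D
proof (induction D rule: finite_psubset_induct)
  case (psubset D)
  show ?case
  proof (cases "D = {}")
    case True
    then show ?thesis using p_sum by simp
  next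
    case False
    define m where "m = Max D"
    have m: "m \<in> D" "\<And>l. l \<in> D \<Longrightarrow> l \<le> m" using False by (auto simp: m_def)
    then have D_eq: "D = insert m {k. k < m}" using psubset.prems
      by (auto simp: order.order_iff_strict)
    have IH: "(\<Sum>j | j \<in> I \<and> (\<forall>l\<in>{k. k < m}. j l = i l). p j) = (\<Prod>l | l < m. cond_weight I p l i)"
      by (rule psubset.IH) (use D_eq in auto)
    have "(\<Sum>j | j \<in> I \<and> (\<forall>k<m. j k = i k). p j) > 0"
      by (rule sum_weight_pos[OF i]) auto
    then have "(\<Sum>j | j \<in> I \<and> (\<forall>k<m. j k = i k) \<and> j m = i m. p j) =
        cond_weight I p m i * (\<Sum>j | j \<in> I \<and> (\<forall>k<m. j k = i k). p j)"
      by (simp add: cond_weight_def)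
    also have "\<dots> = cond_weight I p m i * (\<Prod>l | l < m. cond_weight I p l i)"
      using IH by simp
    also have "\<dots> = (\<Prod>l\<in>D. cond_weight I p l i)" by (simp add: D_eq)
    also have "{j. j \<in> I \<and> (\<forall>k<m. j k = i k) \<and> j m = i m} = {j. j \<in> I \<and> (\<forall>l\<in>D. j l = i l)}"
      by (auto simp: D_eq)
    finally show ?thesis .
  qed
qed

text \<open>Each application of the self-affinity equation removes one symbol from the code and lowers
  every positive \<open>\<kappa> l\<close> by one. The induction is on a common bound of these numbers.\<close>

lemma prob_approx_cube_bounded:
  assumes "range \<sigma> \<subseteq> I" "antimono \<kappa>" "\<And>l. \<kappa> l \<le> K"
  shows "prob (approx_cube \<sigma> \<kappa>) = (\<Prod>l\<in>UNIV. \<Prod>t<\<kappa> l. cond_weight I p l (\<sigma> t))"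
  using assms
proof (induction K arbitrary: \<sigma> \<kappa>)
  case 0
  then have "\<kappa> = (\<lambda>_. 0)" by auto
  then show ?case by (simp add: approx_cube_0 prob_unit_cube)
next
  case (Suc K)
  define D where "D = {l. \<kappa> l \<noteq> 0}"
  define \<kappa>' where "\<kappa>' = (\<lambda>l. \<kappa> l - 1)"
  have "\<sigma> 0 \<in> I" using Suc.prems(1) by auto
  have D_down: "k \<in> D" if "l \<in> D" "k < l" for k l
    using antimonoD[OF Suc.prems(2) less_imp_le[OF that(2)]] that(1) by (auto simp: D_def)
  have "prob (approx_cube \<sigma> \<kappa>) =
      (\<Sum>i\<in>I. p i * prob {x \<in> unit_cube. sponge_map n i x \<in> approx_cube \<sigma> \<kappa>})"
    by (rule measure_self_affine) simp
  also have "\<dots> = (\<Sum>i\<in>I. if \<forall>l\<in>D. i l = \<sigma> 0 l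
      then p i * prob (approx_cube (\<sigma> \<circ> Suc) \<kappa>') else 0)"
    using preimage_approx_cube[OF Suc.prems(1,2)]
      prob_Int_full[OF approx_cube_borel unit_cube_borel prob_unit_cube]
    by (intro sum.cong) (auto simp: D_def \<kappa>'_def)
  also have "\<dots> = (\<Sum>i | i \<in> I \<and> (\<forall>l\<in>D. i l = \<sigma> 0 l). p i) * prob (approx_cube (\<sigma> \<circ> Suc) \<kappa>')"
    by (subst sum.inter_filter[symmetric, OF finite_I]) (simp add: sum_distrib_right)
  also have "(\<Sum>i | i \<in> I \<and> (\<forall>l\<in>D. i l = \<sigma> 0 l). p i) = (\<Prod>l\<in>D. cond_weight I p l (\<sigma> 0))"
    by (rule sum_weight_eq_prod[OF \<open>\<sigma> 0 \<in> I\<close> D_down])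
  also have "\<dots> = (\<Prod>l\<in>UNIV. if l \<in> D then cond_weight I p l (\<sigma> 0) else 1)"
    by (simp add: prod.If_cases)
  also have "prob (approx_cube (\<sigma> \<circ> Suc) \<kappa>') =
      (\<Prod>l\<in>UNIV. \<Prod>t<\<kappa>' l. cond_weight I p l ((\<sigma> \<circ> Suc) t))"
  proof (rule Suc.IH)
    show "range (\<sigma> \<circ> Suc) \<subseteq> I" using Suc.prems(1) by auto
    show "antimono \<kappa>'" using Suc.prems(2) by (auto simp: \<kappa>'_def antimono_def intro: diff_le_mono)
    show "\<kappa>' l \<le> K" for l using Suc.prems(3)[of l] by (simp add: \<kappa>'_def)
  qed
  also have "(\<Prod>l\<in>UNIV. if l \<in> D then cond_weight I p l (\<sigma> 0) else 1) * \<dots> =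
      (\<Prod>l\<in>UNIV. \<Prod>t<\<kappa> l. cond_weight I p l (\<sigma> t))"
    unfolding prod.distrib[symmetric]
  proof (rule prod.cong[OF refl])
    fix l
    show "(if l \<in> D then cond_weight I p l (\<sigma> 0) else 1) *
        (\<Prod>t<\<kappa>' l. cond_weight I p l ((\<sigma> \<circ> Suc) t)) = (\<Prod>t<\<kappa> l. cond_weight I p l (\<sigma> t))"
      by (cases "\<kappa> l") (auto simp: D_def \<kappa>'_def prod.lessThan_Suc_shift simp del: prod.lessThan_Suc)
  qed
  finally show ?case .
qed

lemma prob_approx_cube:
  assumes "range \<sigma> \<subseteq> I" "antimono \<kappa>"
  shows "prob (approx_cube \<sigma> \<kappa>) = (\<Prod>l\<in>UNIV. \<Prod>t<\<kappa> l. cond_weight I p l (\<sigma> t))"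
  by (rule prob_approx_cube_bounded[OF assms, of "Max (range \<kappa>)"]) simp

lemma prob_approx_cube_pos:
  assumes "range \<sigma> \<subseteq> I" "antimono \<kappa>"
  shows "prob (approx_cube \<sigma> \<kappa>) > 0"
  unfolding prob_approx_cube[OF assms] using assms(1)
  by (intro prod_pos ballI cond_weight_pos) auto

section \<open>Coding of the support\<close>

text \<open>Iterating the maps on the cube gives compact sets of full measure. They contain the support,
  and every point of the \<open>K\<close>-th set has a code of length \<open>K\<close>, so finite codes suffice to locate
  support points without constructing the attractor.\<close>

fun level_cover :: "nat \<Rightarrow> (real ^ ('d::{finite, linorder})) set" where
  "level_cover 0 = unit_cube"
| "level_cover (Suc K) = (\<Union>i\<in>I. sponge_map n i ` level_cover K)"

lemma compact_unit_cube: "compact (unit_cube :: (real ^ ('d::{finite, linorder})) set)"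
  unfolding approx_cube_0[of undefined, symmetric] approx_cube_eq_cbox by (rule compact_cbox)

lemma compact_level_cover: "compact (level_cover K)"
proof (induction K)
  case (Suc K)
  then show ?case
    by (auto intro!: compact_UN finite_I compact_continuous_image
        continuous_on_subset[OF continuous_sponge_map])
qed (simp add: compact_unit_cube)

lemma level_cover_borel [measurable]: "level_cover K \<in> sets borel"
  by (intro borel_closed compact_imp_closed compact_level_cover)

lemma sponge_map_unit_cube:
  assumes "i \<in> I" "x \<in> unit_cube"
  shows "sponge_map n i x \<in> unit_cube"
  unfolding unit_cube_def
proof safe
  fix l
  have "0 \<le> x $ l" "x $ l \<le> 1" using assms by (auto simp: unit_cube_def)
  then show "0 \<le> sponge_map n i x $ l" "sponge_map n i x $ l \<le> 1"
    using digit_le[OF assms(1), of l] n_pos[of l] by (simp_all add: sponge_map_def divide_simps)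
qed

lemma level_cover_subset: "level_cover K \<subseteq> unit_cube"
  by (induction K) (auto intro: sponge_map_unit_cube)

lemma prob_level_cover: "prob (level_cover K) = 1"
proof (induction K)
  case (Suc K)
  have "1 = (\<Sum>i\<in>I. p i * prob (level_cover K))"
    using Suc p_sum by simp
  also have "\<dots> \<le> (\<Sum>i\<in>I. p i *
      prob {x \<in> unit_cube. sponge_map n i x \<in> level_cover (Suc K)})"
  proof (intro sum_mono mult_left_mono finite_measure_mono)
    fix i assume i: "i \<in> I"
    show "level_cover K \<subseteq> {x \<in> unit_cube. sponge_map n i x \<in> level_cover (Suc K)}"
      using level_cover_subset[of K] i by auto
    show "{x \<in> unit_cube. sponge_map n i x \<in> level_cover (Suc K)} \<in> events"
      using preimage_borel[OF level_cover_borel[of "Suc K"], of i] by (simp only: sets_mu)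
    show "0 \<le> p i" using p_pos[OF i] by simp
  qed
  also have "\<dots> = prob (level_cover (Suc K))"
    by (rule measure_self_affine[symmetric]) (rule level_cover_borel)
  finally show ?case using prob_le_1[of "level_cover (Suc K)"] by linarith
qed (simp add: prob_unit_cube)

lemma sponge_map_approx_cube:
  assumes "x \<in> approx_cube \<sigma> (\<lambda>_. K)"
  shows "sponge_map n i x \<in> approx_cube (case_nat i \<sigma>) (\<lambda>_. Suc K)"
  unfolding approx_cube_def
proof safe
  fix l
  have comp: "case_nat i \<sigma> \<circ> Suc = \<sigma>" by auto
  have eq: "left_end (case_nat i \<sigma>) (Suc K) l + 1 / real (n l) ^ Suc K =
      (real (i l) + (left_end \<sigma> K l + 1 / real (n l) ^ K)) / real (n l)"
    using n_pos[of l] by (simp add: left_end_shift comp field_simps)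
  have "left_end \<sigma> K l \<le> x $ l" "x $ l \<le> left_end \<sigma> K l + 1 / real (n l) ^ K"
    using assms by (auto simp: approx_cube_def)
  then show "left_end (case_nat i \<sigma>) (Suc K) l \<le> sponge_map n i x $ l"
    "sponge_map n i x $ l \<le> left_end (case_nat i \<sigma>) (Suc K) l + 1 / real (n l) ^ Suc K"
    unfolding eq using n_pos[of l]
    by (auto simp: left_end_shift comp sponge_map_def intro!: divide_right_mono)
qed

lemma level_cover_coded:
  assumes "x \<in> level_cover K"
  obtains \<sigma> where "range \<sigma> \<subseteq> I" "x \<in> approx_cube \<sigma> (\<lambda>_. K)"
  using assms
proof (induction K arbitrary: x thesis)
  case 0
  obtain i where "i \<in> I" using I_nonempty by auto
  then show ?case using 0(1)[of "\<lambda>_. i"] 0(2) by (auto simp: approx_cube_0)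
next
  case (Suc K)
  then obtain i y where i: "i \<in> I" "y \<in> level_cover K" "x = sponge_map n i y" by auto
  obtain \<sigma> where \<sigma>: "range \<sigma> \<subseteq> I" "y \<in> approx_cube \<sigma> (\<lambda>_. K)"
    using Suc.IH i(2) by blast
  have "range (case_nat i \<sigma>) \<subseteq> I" using \<sigma>(1) i(1) by (auto split: nat.splits intro: range_subsetD)
  then show ?case using Suc.prems(1) sponge_map_approx_cube[OF \<sigma>(2), of i] i(3) by blast
qed

text \<open>A closed set of full measure contains the support.\<close>

lemma support_subset_level_cover: "measure_support \<mu> \<subseteq> level_cover K"
proof
  fix x assume x: "x \<in> measure_support \<mu>"
  show "x \<in> level_cover K"
  proof (rule ccontr)
    assume "x \<notin> level_cover K"
    then obtain e where e: "e > 0" "ball x e \<subseteq> - level_cover K"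
      using compact_imp_closed[OF compact_level_cover[of K]]
      by (metis ComplI open_Compl open_contains_ball)
    have "prob (- level_cover K) = 0"
      using prob_compl[of "level_cover K"] prob_level_cover[of K] by (simp add: Compl_eq_Diff_UNIV)
    moreover have "prob (ball x e) \<le> prob (- level_cover K)"
      by (rule finite_measure_mono[OF e(2)]) simp
    ultimately have "prob (ball x e) = 0" using measure_nonneg[of \<mu> "ball x e"] by linarith
    then have "emeasure \<mu> (ball x e) = 0" by (simp add: emeasure_eq_measure)
    then show False using x e(1) unfolding measure_support_def by force
  qed
qed

lemma measure_ball_pos:
  assumes "x \<in> measure_support \<mu>" "r > 0"
  shows "prob (ball x r) > 0"
proof -
  have "emeasure \<mu> (ball x r) > 0" using assms by (auto simp: measure_support_def)
  then show ?thesis by (simp add: emeasure_eq_measure)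
qed

section \<open>Approximate cubes and balls\<close>

text \<open>Take the first coordinate \<open>m\<close> whose prescribed digits differ, and the first position \<open>s\<close> at
  which they do. Earlier coordinates prescribe at least as many digits, so the symbols at position
  \<open>s\<close> agree in them, and the separation condition makes the two digits differ by at least two.
  This leaves a gap of at least the side length \<open>n m\<close> to the power \<open>- (s + 1)\<close>.\<close>

lemma differing_codes_far_apart:
  assumes \<sigma>: "range \<sigma> \<subseteq> I" and \<tau>: "range \<tau> \<subseteq> I" and \<kappa>: "antimono \<kappa>"
    and x: "x \<in> approx_cube \<sigma> \<kappa>" and y: "y \<in> approx_cube \<tau> \<kappa>"
    and diff: "t < \<kappa> l" "\<sigma> t l \<noteq> \<tau> t l"
  shows "\<exists>m. dist x y \<ge> 1 / real (n m) ^ \<kappa> m"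
proof -
  define m where "m = Min {m. \<exists>t<\<kappa> m. \<sigma> t m \<noteq> \<tau> t m}"
  have "m \<in> {m. \<exists>t<\<kappa> m. \<sigma> t m \<noteq> \<tau> t m}"
    unfolding m_def using diff by (intro Min_in) auto
  then have ex: "\<exists>t. t < \<kappa> m \<and> \<sigma> t m \<noteq> \<tau> t m" by blast
  have agree: "\<sigma> t k = \<tau> t k" if "k < m" "t < \<kappa> k" for t k
  proof (rule ccontr)
    assume "\<sigma> t k \<noteq> \<tau> t k"
    then have "m \<le> k" unfolding m_def using that by (intro Min_le) auto
    then show False using that by simp
  qed
  define s where "s = (LEAST t. t < \<kappa> m \<and> \<sigma> t m \<noteq> \<tau> t m)"
  have s: "s < \<kappa> m" "\<sigma> s m \<noteq> \<tau> s m"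
    using LeastI_ex[OF ex] by (simp_all add: s_def)
  have before: "\<sigma> t m = \<tau> t m" if "t < s" for t
    using not_less_Least[of t "\<lambda>t. t < \<kappa> m \<and> \<sigma> t m \<noteq> \<tau> t m"] that s(1) unfolding s_def by auto
  have "s < \<kappa> k" if "k < m" for k
    using antimonoD[OF \<kappa> less_imp_le[OF that]] s(1) by simp
  then have sep: "\<bar>real (\<sigma> s m) - real (\<tau> s m)\<bar> \<ge> 2"
    using \<sigma> \<tau> agree s(2) by (intro separated_digits) auto
  define u where "u = 1 / real (n m) ^ Suc s"
  have u: "u > 0" using n_pos[of m] by (simp add: u_def)
  define a where "a = left_end \<sigma> s m"
  have a': "a = left_end \<tau> s m" unfolding a_def by (rule left_end_cong) (rule before)
  have coord: "left_end \<rho> (Suc s) m \<le> z $ m \<and> z $ m \<le> left_end \<rho> (Suc s) m + u"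
    if "range \<rho> \<subseteq> I" "z \<in> approx_cube \<rho> \<kappa>" for \<rho> z
  proof -
    have "left_end \<rho> (\<kappa> m) m \<le> z $ m" "z $ m \<le> left_end \<rho> (\<kappa> m) m + 1 / real (n m) ^ \<kappa> m"
      using that(2) by (auto simp: approx_cube_def)
    moreover have "Suc s \<le> \<kappa> m" using s(1) by simp
    ultimately show ?thesis
      using left_end_mono[of "Suc s" "\<kappa> m" \<rho> m] right_end_antimono[OF that(1), of "Suc s" "\<kappa> m" m]
      unfolding u_def by linarith
  qed
  have "a + real (\<sigma> s m) * u \<le> x $ m" "x $ m \<le> a + real (\<sigma> s m) * u + u"
    "a + real (\<tau> s m) * u \<le> y $ m" "y $ m \<le> a + real (\<tau> s m) * u + u"
    using coord[OF \<sigma> x] coord[OF \<tau> y] unfolding left_end_Suc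
    by (simp_all add: u_def a_def a'[unfolded a_def])
  moreover have "real (\<sigma> s m) * u \<ge> real (\<tau> s m) * u + 2 * u \<or>
      real (\<tau> s m) * u \<ge> real (\<sigma> s m) * u + 2 * u"
  proof (cases "real (\<sigma> s m) \<ge> real (\<tau> s m) + 2")
    case True
    then have "(real (\<tau> s m) + 2) * u \<le> real (\<sigma> s m) * u" using u by (intro mult_right_mono) auto
    then show ?thesis by (simp add: distrib_right)
  next
    case False
    then have "real (\<sigma> s m) + 2 \<le> real (\<tau> s m)" using sep by linarith
    then have "(real (\<sigma> s m) + 2) * u \<le> real (\<tau> s m) * u" using u by (intro mult_right_mono) auto
    then show ?thesis by (simp add: distrib_right)
  qed
  ultimately have "u \<le> \<bar>(x - y) $ m\<bar>" by (auto simp: abs_if)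
  also have "\<dots> \<le> dist x y" unfolding dist_norm by (rule component_le_norm_cart)
  finally have "u \<le> dist x y" .
  moreover have "1 / real (n m) ^ \<kappa> m \<le> u"
    unfolding u_def using s(1) n_gt_1[of m]
    by (intro divide_left_mono power_increasing mult_pos_pos zero_less_power) auto
  ultimately show ?thesis by (intro exI[of _ m]) linarith
qed

text \<open>For \<open>\<rho> \<le> 1\<close>, the greatest number of digits for which the side \<open>1 / n l ^ level \<rho> l\<close> is at least \<open>\<rho>\<close>.\<close>

definition level :: "real \<Rightarrow> 'd \<Rightarrow> nat" where
  "level \<rho> l = nat \<lfloor>- log (real (n l)) \<rho>\<rfloor>"

lemma level_1 [simp]: "level 1 l = 0"
  by (simp add: level_def)

lemma
  assumes "0 < \<rho>" "\<rho> \<le> 1"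
  shows level_lower: "\<rho> \<le> 1 / real (n l) ^ level \<rho> l"
    and level_upper: "1 / real (n l) ^ level \<rho> l < real (n l) * \<rho>"
proof -
  define b where "b = real (n l)"
  have b: "b > 1" using n_gt_1[of l] by (simp add: b_def)
  define z where "z = - log b \<rho>"
  have "z \<ge> 0" using assms b by (simp add: z_def)
  then have k: "real (level \<rho> l) \<le> z" "z < real (level \<rho> l) + 1"
    unfolding level_def z_def b_def by linarith+
  have \<rho>: "\<rho> = b powr (- z)" using assms b by (simp add: z_def)
  have pw: "1 / b ^ level \<rho> l = b powr (- real (level \<rho> l))"
    using b by (simp add: powr_minus powr_realpow divide_simps)
  have "b powr (- z) \<le> b powr (- real (level \<rho> l))" using k b by simp
  then show "\<rho> \<le> 1 / real (n l) ^ level \<rho> l" using pw \<rho> by (simp add: b_def)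
  have "b powr (- real (level \<rho> l)) < b powr (1 - z)" using k b by simp
  also have "\<dots> = b * \<rho>" using b \<rho> by (simp add: powr_diff powr_minus divide_simps)
  finally show "1 / real (n l) ^ level \<rho> l < real (n l) * \<rho>" using pw by (simp add: b_def)
qed

lemma level_antimono_scale:
  assumes "0 < \<rho>'" "\<rho>' \<le> \<rho>"
  shows "level \<rho> l \<le> level \<rho>' l"
  unfolding level_def using assms n_gt_1[of l]
  by (intro nat_mono floor_mono) auto

lemma antimono_level:
  assumes "0 < \<rho>" "\<rho> \<le> 1"
  shows "antimono (level \<rho>)"
proof (rule antimonoI)
  fix k l :: 'd assume "k \<le> l"
  then have "n k \<le> n l" using strict_mono_mono[OF n_strict_mono] by (simp add: monoD)
  then have "ln (real (n k)) \<le> ln (real (n l))" using n_pos by simp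
  moreover have "ln (real (n k)) > 0" using n_gt_1[of k] by simp
  moreover have "- ln \<rho> \<ge> 0" using assms by simp
  ultimately have "- ln \<rho> / ln (real (n l)) \<le> - ln \<rho> / ln (real (n k))"
    by (intro divide_left_mono mult_pos_pos) auto
  then show "level \<rho> l \<le> level \<rho> k"
    unfolding level_def log_def by (intro nat_mono floor_mono) simp
qed

lemma prob_approx_cube_level_1: "prob (approx_cube \<sigma> (level 1)) = 1"
proof -
  have "level 1 = (\<lambda>_. 0)" by auto
  then show ?thesis by (simp add: approx_cube_0 prob_unit_cube)
qed

text \<open>The sides of an approximate cube at scale \<open>\<rho>\<close> are shorter than \<open>n l * \<rho>\<close>. Adding them up
  bounds its diameter in the taxicab metric, hence also in the Euclidean one.\<close>

definition blow_up :: real where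
  "blow_up = (\<Sum>l\<in>UNIV. real (n l))"

lemma blow_up_ge_1: "blow_up \<ge> 1"
proof -
  fix l :: 'd
  have "real (n l) \<le> blow_up" unfolding blow_up_def by (rule member_le_sum) auto
  then show ?thesis using n_gt_1[of l] by linarith
qed

lemma approx_cube_subset_ball:
  assumes \<rho>: "0 < \<rho>" "\<rho> \<le> 1" and x: "x \<in> approx_cube \<sigma> (level \<rho>)"
  shows "approx_cube \<sigma> (level \<rho>) \<subseteq> ball x (blow_up * \<rho>)"
proof
  fix y assume y: "y \<in> approx_cube \<sigma> (level \<rho>)"
  have "dist x y \<le> (\<Sum>l\<in>UNIV. \<bar>(x - y) $ l\<bar>)"
    unfolding dist_norm by (rule norm_le_l1_cart)
  also have "\<dots> < (\<Sum>l\<in>UNIV. real (n l) * \<rho>)"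
  proof (rule sum_strict_mono)
    fix l
    have "left_end \<sigma> (level \<rho> l) l \<le> z $ l \<and>
        z $ l \<le> left_end \<sigma> (level \<rho> l) l + 1 / real (n l) ^ level \<rho> l"
      if "z \<in> approx_cube \<sigma> (level \<rho>)" for z
      using that by (auto simp: approx_cube_def)
    from this[OF x] this[OF y] have "\<bar>(x - y) $ l\<bar> \<le> 1 / real (n l) ^ level \<rho> l"
      by (simp add: abs_le_iff)
    also have "\<dots> < real (n l) * \<rho>" by (rule level_upper[OF \<rho>])
    finally show "\<bar>(x - y) $ l\<bar> < real (n l) * \<rho>" .
  qed auto
  finally show "y \<in> ball x (blow_up * \<rho>)" by (simp add: blow_up_def sum_distrib_right)
qed

lemma prob_ball_lower:
  assumes \<rho>: "0 < \<rho>" "\<rho> \<le> 1" and x: "x \<in> approx_cube \<sigma> (level \<rho>)"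
  shows "prob (approx_cube \<sigma> (level \<rho>)) \<le> prob (ball x (blow_up * \<rho>))"
  by (rule finite_measure_mono[OF approx_cube_subset_ball[OF assms]]) simp

text \<open>The ball itself need not lie in the approximate cube; only its part in a level cover does,
  since the points there carry codes that can be compared with that of \<open>x\<close>.\<close>

lemma prob_ball_upper:
  assumes \<rho>: "0 < \<rho>" "\<rho> \<le> 1" and \<sigma>: "range \<sigma> \<subseteq> I"
    and x: "x \<in> approx_cube \<sigma> (level \<rho>)"
  shows "prob (ball x \<rho>) \<le> prob (approx_cube \<sigma> (level \<rho>))"
proof -
  define K where "K = Max (range (level \<rho>))"
  have K: "level \<rho> l \<le> K" for l by (simp add: K_def)
  have "level_cover K \<inter> ball x \<rho> \<subseteq> approx_cube \<sigma> (level \<rho>)"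
  proof
    fix y assume y: "y \<in> level_cover K \<inter> ball x \<rho>"
    then obtain \<tau> where \<tau>: "range \<tau> \<subseteq> I" "y \<in> approx_cube \<tau> (\<lambda>_. K)"
      using level_cover_coded by blast
    then have y\<tau>: "y \<in> approx_cube \<tau> (level \<rho>)"
      using approx_cube_antimono[OF \<tau>(1), of "level \<rho>" "\<lambda>_. K"] K by auto
    have agree: "\<sigma> t l = \<tau> t l" if t: "t < level \<rho> l" for t l
    proof (rule ccontr)
      assume "\<sigma> t l \<noteq> \<tau> t l"
      then obtain m where "1 / real (n m) ^ level \<rho> m \<le> dist x y"
        using differing_codes_far_apart[OF \<sigma> \<tau>(1) antimono_level[OF \<rho>] x y\<tau> t] by blast
      then show False using y level_lower[OF \<rho>, of m] by simp
    qed
    have "left_end \<sigma> (level \<rho> l) l = left_end \<tau> (level \<rho> l) l" for l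
      by (rule left_end_cong) (rule agree)
    then show "y \<in> approx_cube \<sigma> (level \<rho>)" using y\<tau> by (simp add: approx_cube_def)
  qed
  then have "prob (level_cover K \<inter> ball x \<rho>) \<le> prob (approx_cube \<sigma> (level \<rho>))"
    by (rule finite_measure_mono) simp
  then show ?thesis by (simp add: prob_Int_full prob_level_cover)
qed

text \<open>A code long enough for the scale \<open>\<rho>\<close> serves all larger scales at once, so the masses of two
  concentric balls can be compared along the same code.\<close>

lemma support_coded:
  assumes "x \<in> measure_support \<mu>" "0 < \<rho>" 
  obtains \<sigma> where "range \<sigma> \<subseteq> I" "\<And>\<rho>'. \<rho> \<le> \<rho>' \<Longrightarrow> x \<in> approx_cube \<sigma> (level \<rho>')"
proof -
  define K where "K = Max (range (level \<rho>))"
  obtain \<sigma> where \<sigma>: "range \<sigma> \<subseteq> I" "x \<in> approx_cube \<sigma> (\<lambda>_. K)"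
    using support_subset_level_cover[of K] assms(1) level_cover_coded by blast
  have "x \<in> approx_cube \<sigma> (level \<rho>')" if "\<rho> \<le> \<rho>'" for \<rho>'
  proof -
    have "level \<rho>' l \<le> K" for l
    proof -
      have "level \<rho>' l \<le> level \<rho> l" by (rule level_antimono_scale[OF assms(2) that])
      also have "\<dots> \<le> K" by (simp add: K_def)
      finally show ?thesis .
    qed
    then show ?thesis using approx_cube_antimono[OF \<sigma>(1), of "level \<rho>'" "\<lambda>_. K"] \<sigma>(2) by auto
  qed
  with \<sigma>(1) show ?thesis by (rule that)
qed

text \<open>Every code is realised, by the nested boxes; the point obtained lies in the support because
  its balls contain approximate cubes, which have positive mass.\<close>

lemma support_point_exists:
  assumes \<sigma>: "range \<sigma> \<subseteq> I"
  obtains x where "x \<in> measure_support \<mu>" "\<And>\<kappa>. x \<in> approx_cube \<sigma> \<kappa>"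
proof -
  have "\<Inter>(range (\<lambda>K::nat. approx_cube \<sigma> (\<lambda>_. K))) \<noteq> {}"
  proof (rule compact_nest)
    fix K :: nat
    have "(\<chi> l. left_end \<sigma> K l) \<in> approx_cube \<sigma> (\<lambda>_. K)" by (simp add: approx_cube_def)
    then show "approx_cube \<sigma> (\<lambda>_. K) \<noteq> {}" by blast
    show "compact (approx_cube \<sigma> (\<lambda>_. K))"
      unfolding approx_cube_eq_cbox by (rule compact_cbox)
  qed (rule approx_cube_antimono[OF \<sigma>])
  then obtain x where x: "x \<in> approx_cube \<sigma> (\<lambda>_. K)" for K by auto
  have x\<kappa>: "x \<in> approx_cube \<sigma> \<kappa>" for \<kappa>
    using x[of "Max (range \<kappa>)"] approx_cube_antimono[OF \<sigma>, of \<kappa> "\<lambda>_. Max (range \<kappa>)"] by auto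
  have "emeasure \<mu> (ball x e) > 0" if "e > 0" for e
  proof -
    define \<rho> where "\<rho> = min 1 (e / blow_up)"
    have \<rho>: "0 < \<rho>" "\<rho> \<le> 1" "blow_up * \<rho> \<le> e"
      using that blow_up_ge_1 by (auto simp: \<rho>_def min_def field_simps)
    have "0 < prob (approx_cube \<sigma> (level \<rho>))"
      by (rule prob_approx_cube_pos[OF \<sigma> antimono_level[OF \<rho>(1,2)]])
    also have "\<dots> \<le> prob (ball x (blow_up * \<rho>))" by (rule prob_ball_lower[OF \<rho>(1,2) x\<kappa>])
    also have "\<dots> \<le> prob (ball x e)"
      by (rule finite_measure_mono) (use \<rho>(3) in \<open>auto intro: subset_ball\<close>)
    finally show ?thesis by (simp add: emeasure_eq_measure)
  qed
  then have "x \<in> measure_support \<mu>" by (simp add: measure_support_def)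
  then show ?thesis using x\<kappa> that by blast
qed

section \<open>Mass loss between two scales\<close>

definition max_exponent :: "'d \<Rightarrow> real" where
  "max_exponent l = (MAX i\<in>I. - ln (cond_weight I p l i) / ln (real (n l)))"

lemma powr_exponent:
  assumes "i \<in> I"
  shows "real (n l) powr - (- ln (cond_weight I p l i) / ln (real (n l))) = cond_weight I p l i"
  using cond_weight_pos[OF assms, of l] n_gt_1[of l] by (simp add: powr_def)

lemma cond_weight_ge:
  assumes "i \<in> I"
  shows "real (n l) powr - max_exponent l \<le> cond_weight I p l i"
proof -
  have "- ln (cond_weight I p l i) / ln (real (n l)) \<le> max_exponent l"
    unfolding max_exponent_def using assms finite_I by (intro Max_ge) auto
  then have "real (n l) powr - max_exponent l
      \<le> real (n l) powr - (- ln (cond_weight I p l i) / ln (real (n l)))"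
    using n_gt_1[of l] by (intro powr_mono) auto
  then show ?thesis by (simp only: powr_exponent[OF assms])
qed

lemma max_exponent_attained:
  obtains i where "i \<in> I" "cond_weight I p l i = real (n l) powr - max_exponent l"
proof -
  have "max_exponent l \<in> (\<lambda>i. - ln (cond_weight I p l i) / ln (real (n l))) ` I"
    unfolding max_exponent_def using finite_I I_nonempty by (intro Max_in) auto
  then obtain i where "i \<in> I" "max_exponent l = - ln (cond_weight I p l i) / ln (real (n l))"
    by auto
  then show ?thesis using that powr_exponent[of i l] by simp
qed

lemma max_exponent_nonneg: "max_exponent l \<ge> 0"
proof -
  obtain i where i: "i \<in> I" using I_nonempty by auto
  have "0 \<le> - ln (cond_weight I p l i) / ln (real (n l))"
    using cond_weight_pos[OF i, of l] cond_weight_le_1[OF i, of l] n_gt_1[of l]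
    by (intro divide_nonneg_pos) auto
  also have "\<dots> \<le> max_exponent l"
    unfolding max_exponent_def using i finite_I by (intro Max_ge) auto
  finally show ?thesis .
qed

definition total_exponent :: real where
  "total_exponent = (\<Sum>l\<in>UNIV. max_exponent l)"

lemma total_exponent_nonneg: "total_exponent \<ge> 0"
  unfolding total_exponent_def by (intro sum_nonneg max_exponent_nonneg)

text \<open>The number of digits read between two scales is the ratio of logarithms only up to one
  digit per coordinate. This constant absorbs the error.\<close>

definition distortion :: real where
  "distortion = (\<Prod>l\<in>UNIV. real (n l) powr max_exponent l)"

lemma distortion_pos: "distortion > 0"
  unfolding distortion_def using n_pos by (intro prod_pos) (auto simp: n_pos)

lemma prod_powr_max_exponent:
  assumes "a > 0"
  shows "(\<Prod>l\<in>UNIV. a powr max_exponent l) = a powr total_exponent"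
  unfolding total_exponent_def using assms by (simp add: powr_sum)

lemma
  assumes "0 < \<rho>'" "\<rho>' \<le> \<rho>" "\<rho> \<le> 1"
  shows power_level_diff_upper:
      "real (n l) ^ (level \<rho>' l - level \<rho> l) \<le> real (n l) * (\<rho> / \<rho>')" (is ?upper)
    and power_level_diff_lower:
      "(\<rho> / \<rho>') / real (n l) \<le> real (n l) ^ (level \<rho>' l - level \<rho> l)" (is ?lower)
proof -
  define N where "N = real (n l)"
  define b b' where "b = N ^ level \<rho> l" and "b' = N ^ level \<rho>' l"
  have pos: "N > 0" "b > 0" "b' > 0" using n_pos[of l] by (simp_all add: b_def b'_def N_def)
  have eq: "real (n l) ^ (level \<rho>' l - level \<rho> l) = b' / b"
    using level_antimono_scale[OF assms(1,2), of l] pos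
    by (simp add: b_def b'_def N_def power_diff)
  have \<rho>: "0 < \<rho>" "\<rho> \<le> 1" "0 < \<rho>'" "\<rho>' \<le> 1" using assms by auto
  have "\<rho> * b \<le> 1" "1 \<le> N * \<rho> * b" "\<rho>' * b' \<le> 1" "1 \<le> N * \<rho>' * b'"
    using level_lower[OF \<rho>(1,2), of l] level_upper[OF \<rho>(1,2), of l]
      level_lower[OF \<rho>(3,4), of l] level_upper[OF \<rho>(3,4), of l] pos
    unfolding N_def[symmetric] b_def[symmetric] b'_def[symmetric]
    by (simp_all add: field_simps)
  then have "(\<rho>' * b') * 1 \<le> 1 * (N * \<rho> * b)" "(\<rho> * b) * 1 \<le> 1 * (N * \<rho>' * b')"
    using \<rho> pos by (intro mult_mono; simp)+
  then show ?upper ?lower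
    unfolding eq unfolding N_def[symmetric] using pos \<rho> by (simp_all add: field_simps)
qed

text \<open>The contribution of the digits that are prescribed at scale \<open>\<rho>'\<close> but not yet at \<open>\<rho>\<close>.\<close>

definition mass_loss :: "(nat \<Rightarrow> 'd multi_index) \<Rightarrow> real \<Rightarrow> real \<Rightarrow> real" where
  "mass_loss \<sigma> \<rho> \<rho>' = (\<Prod>l\<in>UNIV. \<Prod>t\<in>{level \<rho> l..<level \<rho>' l}. cond_weight I p l (\<sigma> t))"

lemma prob_approx_cube_refine:
  assumes \<sigma>: "range \<sigma> \<subseteq> I" and \<rho>: "0 < \<rho>'" "\<rho>' \<le> \<rho>" "\<rho> \<le> 1"
  shows "prob (approx_cube \<sigma> (level \<rho>')) = prob (approx_cube \<sigma> (level \<rho>)) * mass_loss \<sigma> \<rho> \<rho>'"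
proof -
  have anti: "antimono (level \<rho>)" "antimono (level \<rho>')"
    using \<rho> by (auto intro: antimono_level)
  show ?thesis
    unfolding prob_approx_cube[OF \<sigma> anti(1)] prob_approx_cube[OF \<sigma> anti(2)] mass_loss_def
      prod.distrib[symmetric]
  proof (rule prod.cong[OF refl])
    fix l
    have split: "{..<level \<rho>' l} = {..<level \<rho> l} \<union> {level \<rho> l..<level \<rho>' l}"
      using level_antimono_scale[OF \<rho>(1,2), of l] by auto
    show "(\<Prod>t<level \<rho>' l. cond_weight I p l (\<sigma> t)) =
        (\<Prod>t<level \<rho> l. cond_weight I p l (\<sigma> t)) *
        (\<Prod>t\<in>{level \<rho> l..<level \<rho>' l}. cond_weight I p l (\<sigma> t))"
      unfolding split by (rule prod.union_disjoint) auto
  qed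
qed

lemma powr_minus_power: "a > 0 \<Longrightarrow> (a powr - s) ^ k = (a ^ k) powr - s" for a s :: real
  by (simp add: powr_realpow[symmetric] powr_powr mult.commute)

lemma mass_loss_ge:
  assumes \<sigma>: "range \<sigma> \<subseteq> I" and \<rho>: "0 < \<rho>'" "\<rho>' \<le> \<rho>" "\<rho> \<le> 1"
  shows "1 \<le> distortion * (\<rho> / \<rho>') powr total_exponent * mass_loss \<sigma> \<rho> \<rho>'"
proof -
  have q: "\<rho> / \<rho>' > 0" using \<rho> by simp
  define c where "c = distortion * (\<rho> / \<rho>') powr total_exponent"
  have "(\<Prod>l\<in>UNIV. (real (n l) * (\<rho> / \<rho>')) powr - max_exponent l) \<le> mass_loss \<sigma> \<rho> \<rho>'"
    unfolding mass_loss_def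
  proof (rule prod_mono, safe)
    fix l
    define k where "k = level \<rho>' l - level \<rho> l"
    have "(real (n l) * (\<rho> / \<rho>')) powr - max_exponent l \<le> (real (n l) ^ k) powr - max_exponent l"
      using power_level_diff_upper[OF \<rho>, of l] max_exponent_nonneg[of l] n_pos[of l]
      by (intro powr_mono2') (simp_all add: k_def)
    also have "\<dots> = (\<Prod>t\<in>{level \<rho> l..<level \<rho>' l}. real (n l) powr - max_exponent l)"
      by (simp add: powr_minus_power n_pos k_def)
    also have "\<dots> \<le> (\<Prod>t\<in>{level \<rho> l..<level \<rho>' l}. cond_weight I p l (\<sigma> t))"
      using \<sigma> by (intro prod_mono) (auto intro!: cond_weight_ge)
    finally show "(real (n l) * (\<rho> / \<rho>')) powr - max_exponent l
        \<le> (\<Prod>t\<in>{level \<rho> l..<level \<rho>' l}. cond_weight I p l (\<sigma> t))" .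
  qed simp
  also have "(\<Prod>l\<in>UNIV. (real (n l) * (\<rho> / \<rho>')) powr - max_exponent l) =
      inverse (distortion * (\<rho> / \<rho>') powr total_exponent)"
    using q n_pos unfolding distortion_def prod_powr_max_exponent[OF q, symmetric]
    by (simp only: powr_mult powr_minus prod.distrib[symmetric] prod_inversef[symmetric])
      (simp add: prod.distrib prod_inversef)
  finally have "inverse c \<le> mass_loss \<sigma> \<rho> \<rho>'" unfolding c_def .
  moreover have "c > 0" unfolding c_def using distortion_pos q by (intro mult_pos_pos) auto
  ultimately show ?thesis unfolding c_def[symmetric] by (simp add: field_simps)
qed

lemma mass_loss_extremal:
  assumes extremal: "\<And>l t. level \<rho> l \<le> t \<Longrightarrow> t < level \<rho>' l \<Longrightarrow>
      cond_weight I p l (\<sigma> t) = real (n l) powr - max_exponent l"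
    and \<rho>: "0 < \<rho>'" "\<rho>' \<le> \<rho>" "\<rho> \<le> 1"
  shows "(\<rho> / \<rho>') powr total_exponent * mass_loss \<sigma> \<rho> \<rho>' \<le> distortion"
proof -
  have q: "\<rho> / \<rho>' > 0" using \<rho> by simp
  have "mass_loss \<sigma> \<rho> \<rho>' = (\<Prod>l\<in>UNIV. (real (n l) ^ (level \<rho>' l - level \<rho> l)) powr - max_exponent l)"
    unfolding mass_loss_def by (simp add: extremal powr_minus_power n_pos)
  also have "\<dots> \<le> (\<Prod>l\<in>UNIV. ((\<rho> / \<rho>') / real (n l)) powr - max_exponent l)"
    by (intro prod_mono conjI powr_mono2' power_level_diff_lower[OF \<rho>] divide_pos_pos[OF q n_pos])
      (simp_all add: max_exponent_nonneg)
  also have "\<dots> = distortion / (\<rho> / \<rho>') powr total_exponent"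
    unfolding distortion_def prod_powr_max_exponent[OF q, symmetric] prod_dividef[symmetric]
    using q by (intro prod.cong refl)
      (subst powr_divide, simp_all add: powr_minus divide_inverse mult.commute)
  finally have "mass_loss \<sigma> \<rho> \<rho>' \<le> distortion / (\<rho> / \<rho>') powr total_exponent" .
  moreover have "(\<rho> / \<rho>') powr total_exponent > 0" using q by (simp only: powr_gt_zero)
  ultimately show ?thesis by (simp only: pos_le_divide_eq mult.commute)
qed

section \<open>Upper bound for the dimension\<close>

text \<open>Approximate cubes are compared at scales at most one, so both radii are cut off at one:
  this does not increase their ratio, and for \<open>R > 1\<close> the larger cube becomes the whole unit cube.
  The smaller radius is further divided by the blow-up factor to fit a cube into the ball.\<close>

lemma ball_ratio_upper:
  assumes r: "0 < r" "r < R" and x: "x \<in> measure_support \<mu>"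
  shows "prob (ball x R) / prob (ball x r)
    \<le> distortion * blow_up powr total_exponent * (R / r) powr total_exponent"
proof -
  define \<rho> where "\<rho> = min R 1"
  define \<rho>' where "\<rho>' = min r 1 / blow_up"
  have A: "blow_up \<ge> 1" by (rule blow_up_ge_1)
  have "\<rho>' \<le> min r 1 / 1"
    unfolding \<rho>'_def using A r by (intro divide_left_mono) auto
  also have "\<dots> \<le> \<rho>" using r by (simp add: \<rho>_def)
  finally have "\<rho>' \<le> \<rho>" .
  moreover have "0 < \<rho>'" unfolding \<rho>'_def using A r by (intro divide_pos_pos) auto
  moreover have "\<rho> \<le> 1" by (simp add: \<rho>_def)
  moreover have "blow_up * \<rho>' = min r 1" using A by (simp add: \<rho>'_def)
  ultimately have \<rho>: "0 < \<rho>'" "\<rho>' \<le> \<rho>" "\<rho> \<le> 1" "blow_up * \<rho>' = min r 1" by auto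
  obtain \<sigma> where \<sigma>: "range \<sigma> \<subseteq> I" and x\<sigma>: "\<And>\<rho>''. \<rho>' \<le> \<rho>'' \<Longrightarrow> x \<in> approx_cube \<sigma> (level \<rho>'')"
    using support_coded[OF x \<rho>(1)] by blast
  have big: "prob (ball x R) \<le> prob (approx_cube \<sigma> (level \<rho>))"
  proof (cases "R \<le> 1")
    case True
    then have "\<rho> = R" by (simp add: \<rho>_def)
    then show ?thesis using prob_ball_upper[of \<rho> \<sigma> x] \<rho> \<sigma> x\<sigma> by simp
  next
    case False
    then have "\<rho> = 1" by (simp add: \<rho>_def)
    then show ?thesis by (simp add: prob_approx_cube_level_1)
  qed
  have "prob (approx_cube \<sigma> (level \<rho>')) \<le> prob (ball x (blow_up * \<rho>'))"
    using \<rho> x\<sigma> by (intro prob_ball_lower) auto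
  also have "\<dots> \<le> prob (ball x r)"
    unfolding \<rho>(4) by (rule finite_measure_mono) (auto intro: subset_ball)
  finally have small: "prob (approx_cube \<sigma> (level \<rho>')) \<le> prob (ball x r)" .
  define c where "c = distortion * (\<rho> / \<rho>') powr total_exponent"
  have c: "c \<ge> 0" using distortion_pos by (simp add: c_def)
  have "prob (approx_cube \<sigma> (level \<rho>)) * 1
      \<le> prob (approx_cube \<sigma> (level \<rho>)) * (c * mass_loss \<sigma> \<rho> \<rho>')"
    unfolding c_def by (intro mult_left_mono mass_loss_ge[OF \<sigma> \<rho>(1-3)]) simp
  also have "\<dots> = c * prob (approx_cube \<sigma> (level \<rho>'))"
    using prob_approx_cube_refine[OF \<sigma> \<rho>(1-3)] by simp
  also have "\<dots> \<le> c * prob (ball x r)" using small c by (rule mult_left_mono)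
  finally have "prob (ball x R) \<le> c * prob (ball x r)" using big by simp
  moreover have "prob (ball x r) > 0"
    using measure_ball_pos[OF x r(1)] .
  ultimately have "prob (ball x R) / prob (ball x r) \<le> c" by (simp add: divide_le_eq)
  also have "c \<le> distortion * (blow_up * (R / r)) powr total_exponent"
    unfolding c_def
  proof (intro mult_left_mono powr_mono2 total_exponent_nonneg)
    have "min R 1 * r \<le> R * min r 1" using r by (auto simp: min_def)
    then show "\<rho> / \<rho>' \<le> blow_up * (R / r)"
      using A r by (simp add: \<rho>_def \<rho>'_def field_simps)
  qed (use distortion_pos \<rho> in auto)
  also have "\<dots> = distortion * blow_up powr total_exponent * (R / r) powr total_exponent"
    using A r by (subst powr_mult) auto
  finally show ?thesis .
qed

section \<open>Sharpness\<close>

text \<open>Only finitely many quotients \<open>ln (n l) / ln (n k)\<close> with \<open>k < l\<close> occur, and each exceeds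
  one.\<close>

lemma log_ratio_gap:
  obtains \<epsilon> where "\<epsilon> > 0" "\<And>k l. k < l \<Longrightarrow> (1 + \<epsilon>) * ln (real (n k)) \<le> ln (real (n l))"
proof -
  \<comment> \<open>the element 1 keeps the set nonempty when there is only one coordinate\<close>
  define E where "E = insert 1 ((\<lambda>(k, l). ln (real (n l)) / ln (real (n k)) - 1) ` {(k, l). k < l})"
  have E: "finite E" "E \<noteq> {}" by (auto simp: E_def)
  have ln_pos: "ln (real (n l)) > 0" for l using n_gt_1[of l] by simp
  have less: "ln (real (n k)) < ln (real (n l))" if "k < l" for k l
    using strict_monoD[OF n_strict_mono that] n_pos by simp
  show ?thesis
  proof (rule that[of "Min E"])
    have "e > 0" if "e \<in> E" for e
      using that less ln_pos by (auto simp: E_def less_divide_eq)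
    then show "Min E > 0" using E by simp
    fix k l :: 'd assume "k < l"
    then have "Min E \<le> ln (real (n l)) / ln (real (n k)) - 1"
      using E(1) by (intro Min_le) (auto simp: E_def)
    then show "(1 + Min E) * ln (real (n k)) \<le> ln (real (n l))"
      using ln_pos[of k] by (simp add: field_simps)
  qed
qed

text \<open>Under the hypothesis each position is new for at most one coordinate, so there is no
  competition for its symbol.\<close>

lemma extremal_code:
  assumes separated: "\<And>k l. k < l \<Longrightarrow> level \<rho>' l \<le> level \<rho> k"
  obtains \<sigma> where "range \<sigma> \<subseteq> I" "\<And>l t. level \<rho> l \<le> t \<Longrightarrow> t < level \<rho>' l \<Longrightarrow>
      cond_weight I p l (\<sigma> t) = real (n l) powr - max_exponent l"
proof -
  have "\<exists>i. i \<in> I \<and> (\<forall>l. level \<rho> l \<le> t \<and> t < level \<rho>' l \<longrightarrow>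
      cond_weight I p l i = real (n l) powr - max_exponent l)" for t
  proof (cases "\<exists>l. level \<rho> l \<le> t \<and> t < level \<rho>' l")
    case True
    then obtain l where l: "level \<rho> l \<le> t" "t < level \<rho>' l" by blast
    obtain i where i: "i \<in> I" "cond_weight I p l i = real (n l) powr - max_exponent l"
      by (rule max_exponent_attained)
    have "k = l" if "level \<rho> k \<le> t" "t < level \<rho>' k" for k
      using separated[of k l] separated[of l k] l that by (cases k l rule: linorder_cases) auto
    then show ?thesis using i by blast
  next
    case False
    then show ?thesis using I_nonempty by blast
  qed
  then obtain \<sigma> where "\<And>t. \<sigma> t \<in> I \<and> (\<forall>l. level \<rho> l \<le> t \<and> t < level \<rho>' l \<longrightarrow>
      cond_weight I p l (\<sigma> t) = real (n l) powr - max_exponent l)"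
    by metis
  then show ?thesis by (intro that[of \<sigma>]) auto
qed

text \<open>The scale \<open>\<rho>\<close> is tied to the ratio \<open>q\<close> by \<open>\<rho> / q = \<rho> powr (1 + \<epsilon>)\<close>, where \<open>\<epsilon>\<close> is the
  gap between the logarithms. Since rounding down is monotone, the positions are then
  disjoint for every \<open>q > 1\<close>, not only for large ones.\<close>

lemma large_ball_ratio:
  assumes q: "q > 1"
  obtains x \<rho> where "x \<in> measure_support \<mu>" "0 < \<rho>"
    "q powr total_exponent \<le> distortion * (prob (ball x (blow_up * \<rho>)) / prob (ball x (\<rho> / q)))"
proof -
  obtain \<epsilon> where \<epsilon>: "\<epsilon> > 0" "\<And>k l. k < l \<Longrightarrow> (1 + \<epsilon>) * ln (real (n k)) \<le> ln (real (n l))"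
    by (rule log_ratio_gap) blast
  define \<rho> where "\<rho> = q powr (- 1 / \<epsilon>)"
  define \<rho>' where "\<rho>' = \<rho> / q"
  have ln_\<rho>: "ln \<rho> = - (ln q / \<epsilon>)" using q by (simp add: \<rho>_def ln_powr)
  have "\<rho> > 0" using q by (simp add: \<rho>_def)
  have ln_\<rho>': "ln \<rho>' = - ((ln q / \<epsilon>) * (1 + \<epsilon>))"
    using q \<open>\<rho> > 0\<close> \<epsilon>(1) by (simp add: \<rho>'_def ln_div ln_\<rho> field_simps)
  have "ln q > 0" using q by simp
  then have L: "ln q / \<epsilon> > 0" using \<epsilon>(1) by simp
  then have "ln \<rho> \<le> 0" unfolding ln_\<rho> by linarith
  then have "\<rho> \<le> 1" using \<open>\<rho> > 0\<close> by simp
  have \<rho>: "0 < \<rho>'" "\<rho>' \<le> \<rho>" "\<rho> \<le> 1" "\<rho> / \<rho>' = q"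
    using \<open>\<rho> > 0\<close> \<open>\<rho> \<le> 1\<close> q by (auto simp: \<rho>'_def field_simps)
  have separated: "level \<rho>' l \<le> level \<rho> k" if "k < l" for k l
  proof -
    have ln_pos: "ln (real (n m)) > 0" for m using n_gt_1[of m] by simp
    have "(1 + \<epsilon>) / ln (real (n l)) \<le> 1 / ln (real (n k))"
      using \<epsilon>(2)[OF that] ln_pos[of k] ln_pos[of l] by (simp add: field_simps)
    then have "(ln q / \<epsilon>) * ((1 + \<epsilon>) / ln (real (n l))) \<le> (ln q / \<epsilon>) * (1 / ln (real (n k)))"
      using L by (intro mult_left_mono) auto
    then have "- log (real (n l)) \<rho>' \<le> - log (real (n k)) \<rho>"
      unfolding log_def ln_\<rho> ln_\<rho>' by simp
    then show ?thesis unfolding level_def by (intro nat_mono floor_mono)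
  qed
  obtain \<sigma> where \<sigma>: "range \<sigma> \<subseteq> I" and ext: "\<And>l t. level \<rho> l \<le> t \<Longrightarrow> t < level \<rho>' l \<Longrightarrow>
      cond_weight I p l (\<sigma> t) = real (n l) powr - max_exponent l"
    using extremal_code[OF separated] by blast
  obtain x where x: "x \<in> measure_support \<mu>" and x\<sigma>: "\<And>\<kappa>. x \<in> approx_cube \<sigma> \<kappa>"
    using support_point_exists[OF \<sigma>] by blast
  have "q powr total_exponent * prob (ball x \<rho>')
      \<le> q powr total_exponent * prob (approx_cube \<sigma> (level \<rho>'))"
    using \<rho> \<sigma> x\<sigma> by (intro mult_left_mono prob_ball_upper) auto
  also have "\<dots> = (q powr total_exponent * mass_loss \<sigma> \<rho> \<rho>') * prob (approx_cube \<sigma> (level \<rho>))"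
    using prob_approx_cube_refine[OF \<sigma> \<rho>(1-3)] by simp
  also have "\<dots> \<le> distortion * prob (approx_cube \<sigma> (level \<rho>))"
    using mass_loss_extremal[OF ext \<rho>(1-3)] unfolding \<rho>(4) by (intro mult_right_mono) auto
  also have "\<dots> \<le> distortion * prob (ball x (blow_up * \<rho>))"
    using \<open>\<rho> > 0\<close> \<rho>(3) x\<sigma> distortion_pos by (intro mult_left_mono prob_ball_lower) auto
  finally have "q powr total_exponent * prob (ball x \<rho>') \<le> distortion * prob (ball x (blow_up * \<rho>))" .
  moreover have "prob (ball x \<rho>') > 0"
    using measure_ball_pos[OF x \<rho>(1)] .
  ultimately have "q powr total_exponent \<le>
      distortion * (prob (ball x (blow_up * \<rho>)) / prob (ball x \<rho>'))"
    by (simp add: pos_le_divide_eq)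
  then show ?thesis using that[OF x \<open>\<rho> > 0\<close>] unfolding \<rho>'_def by blast
qed

text \<open>An exponent below the total one would bound a positive power of \<open>q\<close> by a constant \<open>D\<close>;
  \<open>q\<close> is chosen to make that power equal to \<open>D + 1\<close>.\<close>

lemma total_exponent_le:
  assumes C: "C > 0" and s: "s \<ge> 0"
    and bound: "\<And>r R x. 0 < r \<Longrightarrow> r < R \<Longrightarrow> x \<in> measure_support \<mu> \<Longrightarrow>
      prob (ball x R) / prob (ball x r) \<le> C * (R / r) powr s"
  shows "total_exponent \<le> s"
proof (rule ccontr)
  assume "\<not> total_exponent \<le> s"
  then have gap: "total_exponent - s > 0" by simp
  define D where "D = distortion * C * blow_up powr s"
  have A: "blow_up \<ge> 1" by (rule blow_up_ge_1)
  have D: "D > 0" using distortion_pos C A by (simp add: D_def)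
  define q where "q = (D + 1) powr (1 / (total_exponent - s))"
  have q: "q > 1" using D gap by (simp add: q_def)
  obtain x \<rho> where x: "x \<in> measure_support \<mu>" "0 < \<rho>"
    and big: "q powr total_exponent \<le>
      distortion * (prob (ball x (blow_up * \<rho>)) / prob (ball x (\<rho> / q)))"
    using large_ball_ratio[OF q] by blast
  have "\<rho> / q < \<rho>" using q x(2) by (simp add: divide_less_eq)
  also have "\<dots> \<le> blow_up * \<rho>" using A x(2) by simp
  finally have "prob (ball x (blow_up * \<rho>)) / prob (ball x (\<rho> / q))
      \<le> C * (blow_up * \<rho> / (\<rho> / q)) powr s"
    using x q by (intro bound) auto
  also have "\<dots> = C * (blow_up * q) powr s" using x(2) by simp
  also have "\<dots> = C * blow_up powr s * q powr s" using A q by (simp add: powr_mult)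
  finally have "distortion * (prob (ball x (blow_up * \<rho>)) / prob (ball x (\<rho> / q)))
      \<le> distortion * (C * blow_up powr s * q powr s)"
    using distortion_pos by (intro mult_left_mono) auto
  with big have "q powr total_exponent \<le> D * q powr s" by (simp add: D_def mult.assoc)
  then have "q powr (total_exponent - s) \<le> D" using q by (simp add: powr_diff divide_le_eq)
  moreover have "q powr (total_exponent - s) = D + 1"
    using gap D by (simp add: q_def powr_powr)
  ultimately show False by simp
qed

theorem upper_regularity_dim_eq: "upper_regularity_dim \<mu> = ereal total_exponent"
proof (rule antisym)
  have "distortion * blow_up powr total_exponent > 0"
    using distortion_pos blow_up_ge_1 by simp
  then show "upper_regularity_dim \<mu> \<le> ereal total_exponent"
    unfolding upper_regularity_dim_def using total_exponent_nonneg ball_ratio_upper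
    by (intro Inf_lower CollectI exI[of _ total_exponent]) blast
  show "ereal total_exponent \<le> upper_regularity_dim \<mu>"
    unfolding upper_regularity_dim_def
  proof (rule Inf_greatest, safe)
    fix s C :: real
    assume "0 \<le> s" "0 < C" "\<forall>r R. 0 < r \<and> r < R \<longrightarrow> (\<forall>x\<in>measure_support \<mu>.
      prob (ball x R) / prob (ball x r) \<le> C * (R / r) powr s)"
    then show "ereal total_exponent \<le> ereal s"
      using total_exponent_le[of C s] by auto
  qed
qed

end

theorem theorem2p6:
  fixes n :: "'d::{finite, linorder} \<Rightarrow> nat"
    and I :: "'d multi_index set"
    and p :: "'d multi_index \<Rightarrow> real"
    and \<mu> :: "(real ^ ('d::{finite, linorder})) measure"
  assumes "CARD('d) \<ge> 2"
    and "\<And>l. 1 < n l"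
    and "strict_mono n"
    and "I \<noteq> {}"
    and "I \<subseteq> {i. \<forall>l. i l \<in> {0..n l - 1}}"
    and "very_strong_separation I"
    and "\<And>i. i \<in> I \<Longrightarrow> p i > 0"
    and "(\<Sum>i\<in>I. p i) = 1"
    and "self_affine_measure n I p \<mu>"
  shows "upper_regularity_dim \<mu> =
    ereal (\<Sum>l\<in>UNIV. MAX i\<in>I. - ln (cond_weight I p l i) / ln (real (n l)))"
proof -
  interpret vssc_sponge n I p \<mu>
    by standard (use assms in auto)
  show ?thesis
    using upper_regularity_dim_eq by (simp only: total_exponent_def max_exponent_def)
qed

end
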